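(* Let $\mathcal A_\alpha:=(A,[\cdot,\cdot],\{\cdot,\cdot,\cdot\},\alpha)$ be a Hom-Bol superalgebra and $\beta:A\to A$ an even self-morphism of $\mathcal A_\alpha$, i.e. an even linear map with $\beta([x,y])=[\beta(x),\beta(y)]$, $\beta(\{x,y,z\})=\{\beta(x),\beta(y),\beta(z)\}$ and $\alpha\circ\beta=\beta\circ\alpha$. Let $\beta^0=\mathrm{Id}$ and $\beta^n=\beta\circ\beta^{n-1}$ for $n\ge1$. For any integer $n\ge0$ define on $A$ $$[x,y]_{\beta^n}:=\beta^n([x,y]),\qquad \{x,y,z\}_{\beta^n}:=\beta^{2n}(\{x,y,z\}).$$ Then $\mathcal A_{\beta^n}:=(A,[\cdot,\cdot]_{\beta^n},\{\cdot,\cdot,\cdot\}_{\beta^n},\beta^n\circ\alpha)$ is a Hom-Bol superalgebra.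
   Context: All vector spaces are over a fixed field of characteristic not $2$ or $3$. A superspace is a $\mathbb Z_2$-graded vector space $A=A_0\oplus A_1$; $\bar x$ is the degree of a homogeneous $x$. A linear map is even if it preserves degrees. A Hom-Bol superalgebra is a quadruple $(A,[\cdot,\cdot],\{\cdot,\cdot,\cdot\},\alpha)$ with $A$ a superspace, $[\cdot,\cdot]$ bilinear, $\{\cdot,\cdot,\cdot\}$ trilinear, $\alpha:A\to A$ even linear, $[A_i,A_j]\subseteq A_{i+j}$, $\{A_i,A_j,A_k\}\subseteq A_{i+j+k}$, and for all homogeneous $u,v,w,x,y,z$: (SHB01) $\alpha([x,y])=[\alpha(x),\alpha(y)]$; (SHB02) $\alpha(\{x,y,z\})=\{\alpha(x),\alpha(y),\alpha(z)\}$; (SHB1) $[x,y]=-(-1)^{\bar x\bar y}[y,x]$; (SHB2) $\{x,y,z\}=-(-1)^{\bar x\bar y}\{y,x,z\}$; (SHB3) $\{x,y,z\}+(-1)^{\bar x(\bar y+\bar z)}\{y,z,x\}+(-1)^{\bar z(\bar x+\bar y)}\{z,x,y\}=0$; (SHB4) $\{\alpha(x),\alpha(y),[u,v]\}=[\{x,y,u\},\alpha^2(v)]+(-1)^{\bar u(\bar x+\bar y)}[\alpha^2(u),\{x,y,v\}]+(-1)^{(\bar x+\bar y)(\bar u+\bar v)}\big(\{\alpha(u),\alpha(v),[x,y]\}-[[\alpha(u),\alpha(v)],[\alpha(x),\alpha(y)]]\big)$; (SHB5) $\{\alpha^2(x),\alpha^2(y),\{u,v,w\}\}=\{\{x,y,u\},\alpha^2(v),\alpha^2(w)\}+(-1)^{\bar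 u(\bar x+\bar y)}\{\alpha^2(u),\{x,y,v\},\alpha^2(w)\}+(-1)^{(\bar x+\bar y)(\bar u+\bar v)}\{\alpha^2(u),\alpha^2(v),\{x,y,w\}\}$. *)

theory Defs
  imports Complex_Main "HOL-Library.Z2"
begin

text \<open>Degrees live in the two-element field \<open>bit\<close>, so sums and products of
  degrees are computed modulo 2. An element of \<open>G i\<close> is a homogeneous element of degree \<open>i\<close>;
  the zero vector is homogeneous of both degrees.\<close>

locale superspace = vector_space scale
  for scale :: "'k::field \<Rightarrow> 'v::ab_group_add \<Rightarrow> 'v"  (infixr \<open>*s\<close> 75) +
  fixes G :: "bit \<Rightarrow> 'v set"
  assumes subspace_G: "subspace (G i)"
    and G_inter: "G 0 \<inter> G 1 = {0}"
    and G_sum: "\<exists>y\<in>G 0. \<exists>z\<in>G 1. x = y + z"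

definition even_linear ::
    "('k::field \<Rightarrow> 'v::ab_group_add \<Rightarrow> 'v) \<Rightarrow> (bit \<Rightarrow> 'v set) \<Rightarrow> ('v \<Rightarrow> 'v) \<Rightarrow> bool" where
  "even_linear scale G f \<longleftrightarrow> Vector_Spaces.linear scale scale f \<and> (\<forall>i. f ` G i \<subseteq> G i)"

text \<open>The sign \<open>(-1)\<^sup>e\<close> for an exponent \<open>e\<close> read modulo 2.\<close>

definition sign_pow :: "bit \<Rightarrow> 'k::field" where
  "sign_pow e = (if e = 0 then 1 else - 1)"

locale hom_bol_superalgebra = superspace scale G
  for scale :: "'k::field \<Rightarrow> 'v::ab_group_add \<Rightarrow> 'v"  (infixr \<open>*s\<close> 75)
    and G :: "bit \<Rightarrow> 'v set" +
  fixes br :: "'v \<Rightarrow> 'v \<Rightarrow> 'v"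
    and tr :: "'v \<Rightarrow> 'v \<Rightarrow> 'v \<Rightarrow> 'v"
    and \<alpha> :: "'v \<Rightarrow> 'v"
  assumes br_linear1: "Vector_Spaces.linear scale scale (\<lambda>x. br x y)"
    and br_linear2: "Vector_Spaces.linear scale scale (\<lambda>y. br x y)"
    and tr_linear1: "Vector_Spaces.linear scale scale (\<lambda>x. tr x y z)"
    and tr_linear2: "Vector_Spaces.linear scale scale (\<lambda>y. tr x y z)"
    and tr_linear3: "Vector_Spaces.linear scale scale (\<lambda>z. tr x y z)"
    and even_\<alpha>: "even_linear scale G \<alpha>"
    and br_degree: "\<lbrakk>x \<in> G i; y \<in> G j\<rbrakk> \<Longrightarrow> br x y \<in> G (i + j)"
    and tr_degree: "\<lbrakk>x \<in> G i; y \<in> G j; z \<in> G k\<rbrakk> \<Longrightarrow> tr x y z \<in> G (i + j + k)"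
    and SHB01: "\<lbrakk>x \<in> G dx; y \<in> G dy\<rbrakk> \<Longrightarrow> \<alpha> (br x y) = br (\<alpha> x) (\<alpha> y)"
    and SHB02: "\<lbrakk>x \<in> G dx; y \<in> G dy; z \<in> G dz\<rbrakk>
      \<Longrightarrow> \<alpha> (tr x y z) = tr (\<alpha> x) (\<alpha> y) (\<alpha> z)"
    and SHB1: "\<lbrakk>x \<in> G dx; y \<in> G dy\<rbrakk> \<Longrightarrow> br x y = - (sign_pow (dx * dy) *s br y x)"
    and SHB2: "\<lbrakk>x \<in> G dx; y \<in> G dy; z \<in> G dz\<rbrakk>
      \<Longrightarrow> tr x y z = - (sign_pow (dx * dy) *s tr y x z)"
    and SHB3: "\<lbrakk>x \<in> G dx; y \<in> G dy; z \<in> G dz\<rbrakk>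
      \<Longrightarrow> tr x y z + sign_pow (dx * (dy + dz)) *s tr y z x
            + sign_pow (dz * (dx + dy)) *s tr z x y = 0"
    and SHB4: "\<lbrakk>x \<in> G dx; y \<in> G dy; u \<in> G du; v \<in> G dv\<rbrakk>
      \<Longrightarrow> tr (\<alpha> x) (\<alpha> y) (br u v)
          = br (tr x y u) (\<alpha> (\<alpha> v))
            + sign_pow (du * (dx + dy)) *s br (\<alpha> (\<alpha> u)) (tr x y v)
            + sign_pow ((dx + dy) * (du + dv)) *s
                (tr (\<alpha> u) (\<alpha> v) (br x y) - br (br (\<alpha> u) (\<alpha> v)) (br (\<alpha> x) (\<alpha> y)))"
    and SHB5: "\<lbrakk>x \<in> G dx; y \<in> G dy; u \<in> G du; v \<in> G dv; w \<in> G dw\<rbrakk>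
      \<Longrightarrow> tr (\<alpha> (\<alpha> x)) (\<alpha> (\<alpha> y)) (tr u v w)
          = tr (tr x y u) (\<alpha> (\<alpha> v)) (\<alpha> (\<alpha> w))
            + sign_pow (du * (dx + dy)) *s tr (\<alpha> (\<alpha> u)) (tr x y v) (\<alpha> (\<alpha> w))
            + sign_pow ((dx + dy) * (du + dv)) *s tr (\<alpha> (\<alpha> u)) (\<alpha> (\<alpha> v)) (tr x y w)"

definition even_self_morphism ::
    "('k::field \<Rightarrow> 'v::ab_group_add \<Rightarrow> 'v) \<Rightarrow> (bit \<Rightarrow> 'v set) \<Rightarrow> ('v \<Rightarrow> 'v \<Rightarrow> 'v)
      \<Rightarrow> ('v \<Rightarrow> 'v \<Rightarrow> 'v \<Rightarrow> 'v) \<Rightarrow> ('v \<Rightarrow> 'v) \<Rightarrow> ('v \<Rightarrow> 'v) \<Rightarrow> bool" where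
  "even_self_morphism scale G br tr \<alpha> \<beta> \<longleftrightarrow>
     even_linear scale G \<beta> \<and>
     (\<forall>x y. \<beta> (br x y) = br (\<beta> x) (\<beta> y)) \<and>
     (\<forall>x y z. \<beta> (tr x y z) = tr (\<beta> x) (\<beta> y) (\<beta> z)) \<and>
     \<alpha> \<circ> \<beta> = \<beta> \<circ> \<alpha>"

end

theory Submission
  imports Defs
begin

text \<open>Only the case of a single twist by a morphism \<open>\<gamma>\<close> matters, since powers of a morphism are
  morphisms. Because \<open>\<gamma>\<close> commutes with all operations, each twisted identity is the original one
  with some power of \<open>\<gamma>\<close> applied to it: \<open>\<gamma>\<^sup>3\<close> for (SHB4), where every term
  involves either one triple product and one bracket or three brackets, and \<open>\<gamma>\<^sup>4\<close> for (SHB5).\<close>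

lemma even_self_morphism_funpow:
  assumes "even_self_morphism scale G br tr \<alpha> \<beta>" and "vector_space scale"
  shows "even_self_morphism scale G br tr \<alpha> (\<beta> ^^ n)"
proof (induction n)
  case 0
  then show ?case
    using vector_space.linear_id[OF assms(2)]
    unfolding even_self_morphism_def even_linear_def funpow_0 funpow.simps(1) by auto
next
  case (Suc n)
  have "Vector_Spaces.linear scale scale (\<beta> \<circ> \<beta> ^^ n)"
    \<comment> \<open>The middle scalar multiplication of a composition does not occur in the goal,
      so it has to be supplied.\<close>
    by (rule Vector_Spaces.linear_compose[where ?s2.0 = scale])
      (use assms(1) Suc.IH in \<open>simp_all only: even_self_morphism_def even_linear_def\<close>)
  moreover have "(\<beta> \<circ> \<beta> ^^ n) ` G i \<subseteq> G i" for i
    using assms(1) Suc.IH unfolding even_self_morphism_def even_linear_def image_comp[symmetric]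
    by (meson image_mono subset_trans)
  moreover have "\<alpha> (\<beta> ((\<beta> ^^ n) x)) = \<beta> ((\<beta> ^^ n) (\<alpha> x))" for x
    using assms(1) Suc.IH unfolding even_self_morphism_def by (metis comp_apply)
  ultimately show ?case
    using assms(1) Suc.IH
    unfolding even_self_morphism_def even_linear_def funpow.simps(2) fun_eq_iff comp_apply by metis
qed

text \<open>Count 1 for each bracket and each \<open>\<alpha>\<close>, and 2 for each triple
  product. In every axiom, the arguments of any one product have equal weight, so \<gamma> can be
  pulled out of it, and all nonzero terms have the same total weight. This balance is why the triple
  product receives \<gamma> twice.\<close>

lemma (in hom_bol_superalgebra) twist:
  assumes "even_self_morphism scale G br tr \<alpha> \<gamma>"
  shows "hom_bol_superalgebra scale G
    (\<lambda>x y. \<gamma> (br x y)) (\<lambda>x y z. \<gamma> (\<gamma> (tr x y z))) (\<lambda>x. \<gamma> (\<alpha> x))"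
proof -
  have lin: "Vector_Spaces.linear scale scale \<gamma>" and deg: "\<And>x i. x \<in> G i \<Longrightarrow> \<gamma> x \<in> G i"
    and br: "\<And>x y. br (\<gamma> x) (\<gamma> y) = \<gamma> (br x y)"
    and tr: "\<And>x y z. tr (\<gamma> x) (\<gamma> y) (\<gamma> z) = \<gamma> (tr x y z)"
    and comm: "\<And>x. \<alpha> (\<gamma> x) = \<gamma> (\<alpha> x)"
    using assms by (auto simp: even_self_morphism_def even_linear_def fun_eq_iff)
  interpret \<gamma>: Vector_Spaces.linear scale scale \<gamma> by (fact lin)
  note comp = Vector_Spaces.linear_compose[unfolded o_def]
  \<comment> \<open>All rules are oriented to move \<gamma> towards the root of a term, so that each
    side becomes a power of \<gamma> applied to the untwisted side.\<close>
  note outward = br tr comm \<gamma>.add[symmetric] \<gamma>.scale[symmetric]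
    \<gamma>.diff[symmetric] \<gamma>.neg[symmetric] \<gamma>.zero
  have lin_\<alpha>: "Vector_Spaces.linear scale scale \<alpha>" and deg_\<alpha>: "\<And>x i. x \<in> G i \<Longrightarrow> \<alpha> x \<in> G i"
    using even_\<alpha> by (auto simp: even_linear_def)
  show ?thesis
  proof (rule hom_bol_superalgebra.intro[OF superspace_axioms],
      rule hom_bol_superalgebra_axioms.intro, goal_cases)
    case (1 y)
    show ?case by (rule comp[OF br_linear1 lin])
  next
    case (2 x)
    show ?case by (rule comp[OF br_linear2 lin])
  next
    case (3 y z)
    show ?case by (rule comp[OF comp[OF tr_linear1 lin] lin])
  next
    case (4 x z)
    show ?case by (rule comp[OF comp[OF tr_linear2 lin] lin])
  next
    case (5 x y)
    show ?case by (rule comp[OF comp[OF tr_linear3 lin] lin])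
  next
    case 6
    show ?case using comp[OF lin_\<alpha> lin] deg deg_\<alpha> by (auto simp: even_linear_def)
  next
    case (7 x i y j)
    then show ?case by (intro deg br_degree)
  next
    case (8 x i y j z k)
    then show ?case by (intro deg tr_degree)
  next
    case (9 x dx y dy)
    \<comment> \<open>The chained identity rewrites the argument beneath the collected powers of
      \<gamma>; nothing is cancelled. The remaining cases follow the same pattern.\<close>
    from SHB01[OF this] show ?case by (simp only: outward)
  next
    case (10 x dx y dy z dz)
    from SHB02[OF this] show ?case by (simp only: outward)
  next
    case (11 x dx y dy)
    from SHB1[OF this] show ?case by (simp only: outward)
  next
    case (12 x dx y dy z dz)
    from SHB2[OF this] show ?case by (simp only: outward)
  next
    case (13 x dx y dy z dz)
    \<comment> \<open>The right-hand side is 0 here, so \<open>\<gamma>.zero\<close> removes the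
      powers of \<gamma> that are left.\<close>
    from SHB3[OF this] show ?case by (simp only: outward)
  next
    case (14 x dx y dy u du v dv)
    from SHB4[OF this] show ?case by (simp only: outward)
  next
    case (15 x dx y dy u du v dv w dw)
    from SHB5[OF this] show ?case by (simp only: outward)
  qed
qed

theorem theorem5p1:
  fixes scale :: "'k::field \<Rightarrow> 'v::ab_group_add \<Rightarrow> 'v"
    and G :: "bit \<Rightarrow> 'v set"
    and br :: "'v \<Rightarrow> 'v \<Rightarrow> 'v"
    and tr :: "'v \<Rightarrow> 'v \<Rightarrow> 'v \<Rightarrow> 'v"
    and \<alpha> \<beta> :: "'v \<Rightarrow> 'v"
    and n :: nat
  assumes "CHAR('k) \<noteq> 2" and "CHAR('k) \<noteq> 3"
    and "hom_bol_superalgebra scale G br tr \<alpha>"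
    and "even_self_morphism scale G br tr \<alpha> \<beta>"
  shows "hom_bol_superalgebra scale G
           (\<lambda>x y. (\<beta> ^^ n) (br x y))
           (\<lambda>x y z. (\<beta> ^^ (2 * n)) (tr x y z))
           ((\<beta> ^^ n) \<circ> \<alpha>)"
proof -
  interpret hom_bol_superalgebra scale G br tr \<alpha> by (fact assms(3))
  have "even_self_morphism scale G br tr \<alpha> (\<beta> ^^ n)"
    by (rule even_self_morphism_funpow[OF assms(4)]) unfold_locales
  from twist[OF this] show ?thesis
    \<comment> \<open>The power \<open>2 * n\<close> splits into two applications of
      \<open>\<beta> ^^ n\<close>, the double \<gamma> of \<open>twist\<close>.\<close>
    unfolding mult_2 funpow_add o_def .
qed

end
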